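(* Let $I=[a,b]$ and $(\rho_n)_{n\in\mathbb{N}}$ be as in the context. For every $n\in\mathbb{N}$, $\delta>0$, and $c\in(0,1)$, one has $|L_{n,\delta}^{(c)}|>0$ and $$1-f_n(\delta)\le\frac{|T_{n,\delta}|}{c\,|L_{n,\delta}^{(c)}|}\sup_{\theta\in T_{n,\delta}}\frac{\rho_n(\theta)}{m_n}\le\frac{|I|}{c\,|L_{n,\delta}^{(c)}|}\sup_{\theta\in T_{n,\delta}}\frac{\rho_n(\theta)}{m_n}.$$
   Context: $I=[a,b]\subset\mathbb{R}$ is a fixed compact interval and, for each $n$, $\rho_n:I\to[0,\infty)$ is continuous with $0<\int_I\rho_n(\theta)\,d\theta<\infty$. $|E|$ denotes the Lebesgue measure of $E\subset\mathbb{R}$. Set $m_n=\max_I\rho_n$ (which is positive) and $A_n=\{\theta\in I:\rho_n(\theta)=m_n\}$ (nonempty, compact). For $\delta>0$ let $U_\delta^I(A_n)=\{\theta\in I:\operatorname{dist}(\theta,A_n)<\delta\}$ and $$f_n(\delta)=\frac{\int_{U_\delta^I(A_n)}\rho_n(\theta)\,d\theta}{\int_I\rho_n(\theta)\,d\theta}.$$ For $\delta>0$ and $c\in(0,1)$ let $$L_{n,\delta}^{(c)}=\{\theta\in U_\delta^I(A_n):\rho_n(\theta)\ge c\,m_n\},\qquad T_{n,\delta}=I\setminus U_\delta^I(A_n).$$ Convention: if $T_{n,\delta}=\varnothing$, then the quantities involving $\sup_{\theta\in T_{n,\delta}}$ are understood to be zero. *)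

theory Defs
  imports "HOL-Analysis.Analysis"
begin

text \<open>
  A density on \<open>I\<close> is a function on all of \<open>\<real>\<close>; only its values on \<open>I\<close> enter below.
\<close>

definition peak_value :: "real set \<Rightarrow> (real \<Rightarrow> real) \<Rightarrow> real" where
  "peak_value I r = (GREATEST v. v \<in> r ` I)"

definition peak_set :: "real set \<Rightarrow> (real \<Rightarrow> real) \<Rightarrow> real set" where
  "peak_set I r = {\<theta> \<in> I. r \<theta> = peak_value I r}"

definition nbhd_in :: "real set \<Rightarrow> real \<Rightarrow> real set \<Rightarrow> real set" where
  "nbhd_in I \<delta> A = {\<theta> \<in> I. infdist \<theta> A < \<delta>}"

definition mass_fraction :: "real set \<Rightarrow> (real \<Rightarrow> real) \<Rightarrow> real \<Rightarrow> real" where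
  "mass_fraction I r \<delta> =
     (LINT \<theta>:nbhd_in I \<delta> (peak_set I r)|lebesgue. r \<theta>) / (LINT \<theta>:I|lebesgue. r \<theta>)"

definition core_set :: "real set \<Rightarrow> (real \<Rightarrow> real) \<Rightarrow> real \<Rightarrow> real \<Rightarrow> real set" where
  "core_set I r \<delta> c = {\<theta> \<in> nbhd_in I \<delta> (peak_set I r). r \<theta> \<ge> c * peak_value I r}"

definition tail_set :: "real set \<Rightarrow> (real \<Rightarrow> real) \<Rightarrow> real \<Rightarrow> real set" where
  "tail_set I r \<delta> = I - nbhd_in I \<delta> (peak_set I r)"

text \<open>
  The supremum over an empty tail is zero by convention; \<open>Sup {}\<close> on the reals would be
  an unspecified value.
\<close>

definition tail_sup :: "real set \<Rightarrow> (real \<Rightarrow> real) \<Rightarrow> real \<Rightarrow> real" where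
  "tail_sup I r \<delta> =
     (if tail_set I r \<delta> = {} then 0 else (SUP \<theta>\<in>tail_set I r \<delta>. r \<theta> / peak_value I r))"

end

theory Submission
  imports Defs
begin

text \<open>
  The tail mass is at most \<open>|T| * m * sup\<^sub>T (\<rho> / m)\<close>, while the total mass is at least the
  mass of the core, hence at least \<open>c * m * |L|\<close>; their quotient is \<open>1 - f\<close>. The core has
  positive measure because it contains a relative neighbourhood of a maximiser.
\<close>

text \<open>Finite measure of \<open>E\<close> makes the constant \<open>K\<close> integrable on it,
  so monotonicity of the integral applies. This form bounds the tail mass from above and also
  excludes a zero peak.\<close>

lemma set_integral_le_const_measure:
  fixes f :: "'a \<Rightarrow> real"
  assumes "set_integrable M E f" "E \<in> fmeasurable M" "\<And>x. x \<in> E \<Longrightarrow> f x \<le> K"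
  shows "(LINT x:E|M. f x) \<le> K * measure M E"
proof -
  have "(LINT x:E|M. f x) \<le> (LINT x:E|M. K)"
    using assms by (intro set_integral_mono) (auto simp: set_integrable_def fmeasurable_def)
  then show ?thesis
    using assms(2) by (simp add: set_lebesgue_integral_def fmeasurable_def mult.commute)
qed

lemma set_integral_ge_const_measure:
  fixes f :: "'a \<Rightarrow> real"
  assumes "set_integrable M E f" "E \<in> fmeasurable M" "\<And>x. x \<in> E \<Longrightarrow> K \<le> f x"
  shows "K * measure M E \<le> (LINT x:E|M. f x)"
proof -
  have "(LINT x:E|M. K) \<le> (LINT x:E|M. f x)"
    using assms by (intro set_integral_mono) (auto simp: set_integrable_def fmeasurable_def)
  then show ?thesis
    using assms(2) by (simp add: set_lebesgue_integral_def fmeasurable_def mult.commute)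
qed

text \<open>\<open>GREATEST\<close> has a usable value only when a largest element exists;
  compactness and continuity supply one. Later facts about \<open>peak_value\<close> rest on
  this.\<close>

lemma peak_value_attained:
  fixes r :: "real \<Rightarrow> real"
  assumes "compact I" "I \<noteq> {}" "continuous_on I r"
  obtains x where "x \<in> I" "r x = peak_value I r" "\<And>y. y \<in> I \<Longrightarrow> r y \<le> peak_value I r"
proof -
  obtain x where x: "x \<in> I" "\<And>y. y \<in> I \<Longrightarrow> r y \<le> r x"
    using continuous_attains_sup[OF assms] by blast
  have "peak_value I r = r x"
    unfolding peak_value_def using x by (intro Greatest_equality) auto
  with x show thesis using that by metis
qed

lemma lmeasurable_nbhd_in:
  assumes "I \<in> lmeasurable"
  shows "nbhd_in I \<delta> A \<in> lmeasurable"
proof -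
  have "open {x. infdist x A < \<delta>}"
    by (intro open_Collect_less continuous_intros)
  then have "I \<inter> {x. infdist x A < \<delta>} \<in> lmeasurable"
    by (intro fmeasurable_Int_fmeasurable assms) simp
  also have "I \<inter> {x. infdist x A < \<delta>} = nbhd_in I \<delta> A"
    by (auto simp: nbhd_in_def)
  finally show ?thesis .
qed

lemma lmeasurable_core_set:
  assumes "compact I" "continuous_on I r"
  shows "core_set I r \<delta> c \<in> lmeasurable"
proof -
  have "closed {x \<in> I. c * peak_value I r \<le> r x}"
    using assms by (intro continuous_on_closed_Collect_le continuous_intros compact_imp_closed)
  then have "nbhd_in I \<delta> (peak_set I r) \<inter> {x \<in> I. c * peak_value I r \<le> r x} \<in> lmeasurable"
    using assms(1)
    by (intro fmeasurable_Int_fmeasurable lmeasurable_nbhd_in lmeasurable_compact) auto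
  also have "nbhd_in I \<delta> (peak_set I r) \<inter> {x \<in> I. c * peak_value I r \<le> r x} = core_set I r \<delta> c"
    by (auto simp: core_set_def nbhd_in_def)
  finally show ?thesis .
qed

lemma measure_core_set_pos:
  fixes r :: "real \<Rightarrow> real"
  assumes "a < b" "continuous_on {a..b} r" "0 < peak_value {a..b} r" "0 < \<delta>" "c < 1"
  shows "0 < measure lebesgue (core_set {a..b} r \<delta> c)"
proof -
  let ?M = "peak_value {a..b} r"
  obtain x where x: "x \<in> {a..b}" "r x = ?M"
    using peak_value_attained[of "{a..b}" r] assms(1,2) by auto
  \<comment> \<open>This is the gap between the peak and the threshold \<open>c * ?M\<close>: a
    point where \<open>r\<close> differs from its maximum by less than the gap stays above the
    threshold.\<close>
  have "0 < (1 - c) * ?M" using assms by simp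
  then obtain e where e: "0 < e" "\<And>y. y \<in> {a..b} \<Longrightarrow> dist y x < e \<Longrightarrow> dist (r y) (r x) < (1 - c) * ?M"
    using assms(2) x(1) unfolding continuous_on_iff by blast
  \<comment> \<open>Radius \<open>e\<close> controls the values of \<open>r\<close>, radius \<delta>
    membership in the neighbourhood of the peak set. Clipping by \<open>a\<close> and
    \<open>b\<close> keeps the open interval from \<open>u\<close> to \<open>v\<close> inside the
    domain.\<close>
  define d where "d = min e \<delta>"
  define u where "u = max a (x - d)"
  define v where "v = min b (x + d)"
  have "d > 0" using e assms by (simp add: d_def)
  \<comment> \<open>The maximiser may be an endpoint, where clipping removes one side;
    \<open>a < b\<close> leaves the other side nondegenerate.\<close>
  then have uv: "u < v" using x(1) assms(1) by (auto simp: u_def v_def)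
  have "{u<..<v} \<subseteq> core_set {a..b} r \<delta> c"
  proof
    fix y assume "y \<in> {u<..<v}"
    then have y: "y \<in> {a..b}" "dist y x < e" "dist y x < \<delta>"
      by (auto simp: u_def v_def d_def dist_real_def)
    have "x \<in> peak_set {a..b} r" using x by (simp add: peak_set_def)
    then have "infdist y (peak_set {a..b} r) < \<delta>"
      using infdist_le[of x _ y] y(3) by (blast intro: le_less_trans)
    moreover have "c * ?M \<le> r y"
      using e(2)[OF y(1,2)] x(2) by (simp add: dist_real_def algebra_simps)
    ultimately show "y \<in> core_set {a..b} r \<delta> c"
      using y(1) by (simp add: core_set_def nbhd_in_def)
  qed
  then have "measure lebesgue {u<..<v} \<le> measure lebesgue (core_set {a..b} r \<delta> c)"
    using assms(2) by (intro measure_mono_fmeasurable lmeasurable_core_set) auto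
  with uv show ?thesis by simp
qed

text \<open>On the reals a supremum dominates its members only for a bounded family; here the ratios
  are bounded by 1.\<close>

lemma le_tail_sup:
  fixes r :: "real \<Rightarrow> real"
  assumes "compact I" "continuous_on I r" "0 < peak_value I r" "x \<in> tail_set I r \<delta>"
  shows "r x / peak_value I r \<le> tail_sup I r \<delta>"
proof -
  have "x \<in> I" using assms(4) by (simp add: tail_set_def)
  have "\<And>y. y \<in> I \<Longrightarrow> r y \<le> peak_value I r"
    using peak_value_attained[OF assms(1) _ assms(2)] \<open>x \<in> I\<close> by blast
  then have "bdd_above ((\<lambda>y. r y / peak_value I r) ` tail_set I r \<delta>)"
    using assms(3) by (intro bdd_aboveI[of _ 1]) (auto simp: tail_set_def)
  then show ?thesis
    using assms(4) by (auto simp: tail_sup_def intro: cSUP_upper)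
qed

text \<open>The empty tail is settled by the convention, any other by one of its points. The sign is
  what allows a denominator to be shrunk, or a factor enlarged, next to the supremum.\<close>

lemma tail_sup_nonneg:
  fixes r :: "real \<Rightarrow> real"
  assumes "compact I" "continuous_on I r" "0 < peak_value I r" "\<And>x. x \<in> I \<Longrightarrow> 0 \<le> r x"
  shows "0 \<le> tail_sup I r \<delta>"
proof (cases "tail_set I r \<delta> = {}")
  case True
  then show ?thesis by (simp add: tail_sup_def)
next
  case False
  then obtain x where x: "x \<in> tail_set I r \<delta>" by blast
  then have "0 \<le> r x / peak_value I r"
    using assms(3,4) by (simp add: tail_set_def)
  also have "\<dots> \<le> tail_sup I r \<delta>" by (rule le_tail_sup) (use assms x in auto)
  finally show ?thesis .
qed

lemma mass_fraction_deficit_le: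
  fixes r :: "real \<Rightarrow> real"
  assumes "compact I" "continuous_on I r" "\<And>x. x \<in> I \<Longrightarrow> 0 \<le> r x"
    and int: "set_integrable lebesgue I r" and pos: "0 < (LINT x:I|lebesgue. r x)"
    and M: "0 < peak_value I r" and c: "0 < c"
    and core: "0 < measure lebesgue (core_set I r \<delta> c)"
  shows "1 - mass_fraction I r \<delta>
    \<le> measure lebesgue (tail_set I r \<delta>) / (c * measure lebesgue (core_set I r \<delta> c)) * tail_sup I r \<delta>"
proof -
  define M where "M = peak_value I r"
  define N where "N = nbhd_in I \<delta> (peak_set I r)"
  define T where "T = tail_set I r \<delta>"
  define L where "L = core_set I r \<delta> c"
  define J where "J = (LINT x:I|lebesgue. r x)"
  define S where "S = tail_sup I r \<delta>"
  have I: "I \<in> lmeasurable" using assms(1) by (rule lmeasurable_compact)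
  have N: "N \<in> lmeasurable" "N \<subseteq> I"
    using lmeasurable_nbhd_in[OF I] by (auto simp: N_def nbhd_in_def)
  have T: "T = I - N" by (simp add: T_def N_def tail_set_def)
  have Tm: "T \<in> lmeasurable" unfolding T using I N by blast
  have L: "L \<in> lmeasurable" "L \<subseteq> I"
    using lmeasurable_core_set assms(1,2) by (auto simp: L_def core_set_def nbhd_in_def)
  have sub: "set_integrable lebesgue E r" if "E \<in> lmeasurable" "E \<subseteq> I" for E
    using set_integrable_subset[OF int] that by (auto simp: fmeasurableD)
  have split: "J = (LINT x:N|lebesgue. r x) + (LINT x:T|lebesgue. r x)"
    using set_integral_Un[of N T lebesgue r] sub[OF N] sub[OF Tm] N(2)
    by (simp add: J_def T Un_absorb1)
  have tail: "(LINT x:T|lebesgue. r x) \<le> M * S * measure lebesgue T"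
  proof (rule set_integral_le_const_measure)
    fix x assume "x \<in> T"
    then have "r x / M \<le> S"
      using le_tail_sup[OF assms(1,2) M] by (simp add: T_def S_def M_def)
    then show "r x \<le> M * S" using M by (simp add: M_def field_simps)
  qed (use Tm sub T in auto)
  have "c * M * measure lebesgue L \<le> (LINT x:L|lebesgue. r x)"
    by (rule set_integral_ge_const_measure) (use L sub in \<open>auto simp: L_def core_set_def M_def\<close>)
  \<comment> \<open>Enlarging the domain from \<open>L\<close> to \<open>I\<close> can only add
    mass, since \<open>r\<close> is nonnegative on \<open>I\<close>.\<close>
  also have "\<dots> \<le> J"
    unfolding J_def set_lebesgue_integral_def
    using sub[OF L] int L(2) assms(3)
    by (intro integral_mono) (auto simp: set_integrable_def indicator_def)
  finally have total: "c * M * measure lebesgue L \<le> J" .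
  have S: "0 \<le> S" using tail_sup_nonneg[OF assms(1,2) M assms(3)] by (simp add: S_def)
  \<comment> \<open>The neighbourhood and the tail partition \<open>I\<close>, and \<open>J\<close>
    is nonzero, so the deficit is exactly the tail's share of the mass.\<close>
  have "1 - mass_fraction I r \<delta> = (LINT x:T|lebesgue. r x) / J"
    using pos split by (simp add: mass_fraction_def N_def[symmetric] J_def[symmetric] field_simps)
  also have "\<dots> \<le> M * S * measure lebesgue T / J"
    using tail pos by (intro divide_right_mono) (auto simp: J_def)
  \<comment> \<open>The total mass is replaced by its lower bound from the core. The quotient grows
    because the numerator is nonnegative and the new denominator is still positive; \<open>M\<close>
    then cancels.\<close>
  also have "\<dots> \<le> M * S * measure lebesgue T / (c * M * measure lebesgue L)"
    using total S M c core by (intro divide_left_mono mult_nonneg_nonneg mult_pos_pos)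
      (auto simp: M_def L_def J_def pos)
  also have "\<dots> = measure lebesgue T / (c * measure lebesgue L) * S"
    using M by (simp add: M_def)
  finally show ?thesis by (simp add: T_def L_def S_def)
qed

theorem proposition2p1:
  fixes a b :: real and \<rho> :: "nat \<Rightarrow> real \<Rightarrow> real"
  assumes "a \<le> b"
    and "\<And>n. continuous_on {a..b} (\<rho> n)"
    and "\<And>n \<theta>. \<theta> \<in> {a..b} \<Longrightarrow> 0 \<le> \<rho> n \<theta>"
    and "\<And>n. set_integrable lebesgue {a..b} (\<rho> n)"
    and "\<And>n. 0 < (LINT \<theta>:{a..b}|lebesgue. \<rho> n \<theta>)"
  shows "\<forall>n. \<forall>\<delta>>0. \<forall>c\<in>{0<..<1}.
    measure lebesgue (core_set {a..b} (\<rho> n) \<delta> c) > 0 \<and>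
    1 - mass_fraction {a..b} (\<rho> n) \<delta>
      \<le> measure lebesgue (tail_set {a..b} (\<rho> n) \<delta>)
          / (c * measure lebesgue (core_set {a..b} (\<rho> n) \<delta> c)) * tail_sup {a..b} (\<rho> n) \<delta> \<and>
    measure lebesgue (tail_set {a..b} (\<rho> n) \<delta>)
          / (c * measure lebesgue (core_set {a..b} (\<rho> n) \<delta> c)) * tail_sup {a..b} (\<rho> n) \<delta>
      \<le> measure lebesgue {a..b}
          / (c * measure lebesgue (core_set {a..b} (\<rho> n) \<delta> c)) * tail_sup {a..b} (\<rho> n) \<delta>"
proof (intro allI impI ballI)
  fix n and \<delta> c :: real
  assume \<delta>: "0 < \<delta>" and c: "c \<in> {0<..<1}"
  let ?I = "{a..b}" and ?r = "\<rho> n"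
  let ?M = "peak_value ?I ?r"
  obtain x where x: "x \<in> ?I" "?r x = ?M" "\<And>y. y \<in> ?I \<Longrightarrow> ?r y \<le> ?M"
    using peak_value_attained[of ?I ?r] assms(1,2) by auto
  \<comment> \<open>Positive total mass forces \<open>?M * (b - a)\<close> to be positive. Since
    \<open>a \<le> b\<close> rules out two negative factors, this yields both a positive peak and a
    nondegenerate interval.\<close>
  have "(LINT \<theta>:?I|lebesgue. ?r \<theta>) \<le> ?M * measure lebesgue ?I"
    by (rule set_integral_le_const_measure) (use assms(4) x(3) in auto)
  then have "0 < ?M * (b - a)" using assms(1) assms(5)[of n] by simp
  then have M: "0 < ?M" and ab: "a < b"
    using assms(1) by (auto simp: zero_less_mult_iff)
  have core: "0 < measure lebesgue (core_set ?I ?r \<delta> c)"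
    using measure_core_set_pos[OF ab assms(2) M \<delta>] c by simp
  have deficit: "1 - mass_fraction ?I ?r \<delta> \<le> measure lebesgue (tail_set ?I ?r \<delta>)
      / (c * measure lebesgue (core_set ?I ?r \<delta> c)) * tail_sup ?I ?r \<delta>"
    by (rule mass_fraction_deficit_le) (use assms M c core in auto)
  have "measure lebesgue (tail_set ?I ?r \<delta>) \<le> measure lebesgue ?I"
    unfolding tail_set_def
    by (intro measure_mono_fmeasurable sets.Diff fmeasurableD lmeasurable_nbhd_in) auto
  then have "measure lebesgue (tail_set ?I ?r \<delta>)
      / (c * measure lebesgue (core_set ?I ?r \<delta> c)) * tail_sup ?I ?r \<delta>
      \<le> measure lebesgue ?I / (c * measure lebesgue (core_set ?I ?r \<delta> c)) * tail_sup ?I ?r \<delta>"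
    using c core tail_sup_nonneg[OF _ assms(2) M assms(3)]
    by (intro mult_right_mono divide_right_mono) auto
  with core deficit show "0 < measure lebesgue (core_set ?I ?r \<delta> c) \<and>
      1 - mass_fraction ?I ?r \<delta> \<le> measure lebesgue (tail_set ?I ?r \<delta>)
        / (c * measure lebesgue (core_set ?I ?r \<delta> c)) * tail_sup ?I ?r \<delta> \<and>
      measure lebesgue (tail_set ?I ?r \<delta>)
        / (c * measure lebesgue (core_set ?I ?r \<delta> c)) * tail_sup ?I ?r \<delta>
      \<le> measure lebesgue ?I / (c * measure lebesgue (core_set ?I ?r \<delta> c)) * tail_sup ?I ?r \<delta>"
    by blast
qed

end
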